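(* Let $X=\{X_i, i=0,1,\ldots\}$ be a Markov chain on $\mathcal{X}$ satisfying assumption $(\mathcal{A})$ (defined in the context). Suppose there exist $V:\mathcal{X}\to[0,\infty)$, $\gamma\in(0,1)$ and $b<\infty$ such that $$E[V(X_{n+1})\mid X_n=x]\le \gamma V(x)+b\qquad\text{for all }x\in\mathcal{X}.$$ Set $W(x)=1+V(x)$. Then, for any $a>0$, $$E[W(X_{n+1})\mid X_n=x]\le \rho W(x)+L\,I_C(x)\qquad\text{for all }x\in\mathcal{X},$$ where $\rho=(a+\gamma)/(a+1)$, $L=b+(1-\gamma)$ and $$C=\left\{x\in\mathcal{X}: W(x)\le\frac{(a+1)L}{a(1-\rho)}\right\}.$$
   Context: $\mathcal{X}\subset\mathbb{R}^p$ ($p\ge1$) has Borel $\sigma$-algebra $\mathcal{B}$, and $X$ is a discrete time, time homogeneous Markov chain with state space $\mathcal{X}$. The chain satisfies assumption $(\mathcal{A})$ if, for some measure $\nu$ on $\mathcal{B}$, it is $\nu$-irreducible, aperiodic and positive Harris recurrent with invariant probability measure $\pi(\cdot)$. $I_C$ denotes the indicator function of $C$. *)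

theory Defs
  imports "HOL-Probability.Probability"
begin

section \<open>State space, kernel, process\<close>

text \<open>The set \<open>S\<close> of states need not be a Borel set; it carries its own (relative) Borel
  \<open>\<sigma>\<close>-algebra.\<close>

abbreviation state_space :: "'a::topological_space set \<Rightarrow> 'a measure" where
  "state_space S \<equiv> restrict_space borel S"

definition transition_kernel :: "'a measure \<Rightarrow> ('a \<Rightarrow> 'a measure) \<Rightarrow> bool" where
  "transition_kernel N K \<longleftrightarrow> K \<in> measurable N (prob_algebra N)"

definition history :: "'a measure \<Rightarrow> 'w measure \<Rightarrow> (nat \<Rightarrow> 'w \<Rightarrow> 'a) \<Rightarrow> nat \<Rightarrow> 'w measure" where
  "history N M X n =
     sigma (space M) {X i -` A \<inter> space M | i A. i \<le> n \<and> A \<in> sets N}"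

text \<open>Time homogeneity: one kernel \<open>K\<close> serves all times \<open>n\<close>. The initial distribution is
  arbitrary.\<close>

definition markov_chain ::
  "'a measure \<Rightarrow> 'w measure \<Rightarrow> (nat \<Rightarrow> 'w \<Rightarrow> 'a) \<Rightarrow> ('a \<Rightarrow> 'a measure) \<Rightarrow> bool" where
  "markov_chain N M X K \<longleftrightarrow>
     prob_space M \<and> transition_kernel N K \<and> (\<forall>n. X n \<in> measurable M N) \<and>
     (\<forall>n. \<forall>A\<in>sets N. AE \<omega> in M.
        real_cond_exp M (history N M X n) (indicator (X (Suc n) -` A \<inter> space M)) \<omega>
          = measure (K (X n \<omega>)) A)"

text \<open>\<open>E[f(X\<^sub>n\<^sub>+\<^sub>1) | X\<^sub>n = x]\<close> for \<open>f \<ge> 0\<close>, at every point \<open>x\<close>: the integral against the regular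
  conditional distribution \<open>K x\<close> of \<open>X\<^sub>n\<^sub>+\<^sub>1\<close> given \<open>X\<^sub>n = x\<close>, the same for every \<open>n\<close> and possibly
  \<open>\<infinity>\<close>. The value lies in \<^typ>\<open>ereal\<close> because real bounds embed there faithfully, whereas
  \<^const>\<open>ennreal\<close> sends negative bounds to 0.\<close>

definition next_step_expectation :: "('a \<Rightarrow> 'a measure) \<Rightarrow> ('a \<Rightarrow> real) \<Rightarrow> 'a \<Rightarrow> ereal" where
  "next_step_expectation K f x = enn2ereal (\<integral>\<^sup>+ y. ennreal (f y) \<partial>K x)"


section \<open>Law of the trajectory started at a point\<close>

definition path_step :: "'a measure \<Rightarrow> ('a \<Rightarrow> 'a measure) \<Rightarrow> 'a \<Rightarrow> nat \<Rightarrow> (nat \<Rightarrow> 'a) \<Rightarrow> 'a measure"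
  where
  "path_step N K x n \<omega> = (case n of 0 \<Rightarrow> return N x | Suc m \<Rightarrow> K (\<omega> m))"

text \<open>\<open>P\<^sub>x\<close>, the Ionescu--Tulcea measure on the sequence space.\<close>

definition path_law :: "'a measure \<Rightarrow> ('a \<Rightarrow> 'a measure) \<Rightarrow> 'a \<Rightarrow> (nat \<Rightarrow> 'a) measure" where
  "path_law N K x =
     projective_family.lim UNIV (Ionescu_Tulcea.CI (path_step N K x) (\<lambda>_. N)) (\<lambda>_. N)"

lemma Ionescu_Tulcea_path_step:
  assumes K: "transition_kernel N K" and x: "x \<in> space N"
  shows "Ionescu_Tulcea (path_step N K x) (\<lambda>_. N)"
proof -
  have K': "K \<in> measurable N (subprob_algebra N)"
    using K by (auto simp: transition_kernel_def dest: measurable_prob_algebraD)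
  have "path_step N K x i \<in> measurable (PiM {0..<i} (\<lambda>_. N)) (subprob_algebra N)" for i
  proof (cases i)
    case 0
    have "return N x \<in> space (subprob_algebra N)"
      using x by (rule measurable_space[OF return_measurable])
    then show ?thesis
      by (simp add: 0 path_step_def[abs_def])
  next
    case (Suc m)
    have "(\<lambda>\<omega>. K (\<omega> m)) \<in> measurable (PiM {0..<Suc m} (\<lambda>_. N)) (subprob_algebra N)"
      by (rule measurable_compose[OF _ K'], rule measurable_component_singleton) simp
    then show ?thesis
      by (simp add: Suc path_step_def[abs_def])
  qed
  moreover have "prob_space (path_step N K x i \<omega>)"
    if \<omega>: "\<omega> \<in> space (PiM {0..<i} (\<lambda>_. N))" for i \<omega>
  proof (cases i)
    case 0
    then show ?thesis
      using x by (simp add: path_step_def prob_space_return)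
  next
    case (Suc m)
    then have "\<omega> m \<in> space N"
      using \<omega> by (auto simp: space_PiM PiE_iff)
    then show ?thesis
      using K measurable_space[of K N "prob_algebra N" "\<omega> m"]
      by (simp add: Suc path_step_def transition_kernel_def space_prob_algebra)
  qed
  ultimately show ?thesis
    by (simp add: Ionescu_Tulcea_def)
qed


section \<open>Irreducibility, periodicity, Harris recurrence\<close>

text \<open>Terminology follows Meyn and Tweedie. Visits are counted from time 1 on. Without
  \<open>\<nu> \<noteq> 0\<close> the notion would be void.\<close>

definition irreducibility_measure :: "'a measure \<Rightarrow> ('a \<Rightarrow> 'a measure) \<Rightarrow> 'a measure \<Rightarrow> bool" where
  "irreducibility_measure N K \<nu> \<longleftrightarrow>
     sets \<nu> = sets N \<and> emeasure \<nu> (space N) > 0 \<and>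
     (\<forall>A\<in>sets N. emeasure \<nu> A > 0 \<longrightarrow>
        (\<forall>x\<in>space N.
           emeasure (path_law N K x) {\<omega> \<in> space (path_law N K x). \<exists>n\<ge>1. \<omega> n \<in> A} > 0))"

definition maximal_irreducibility_measure ::
  "'a measure \<Rightarrow> ('a \<Rightarrow> 'a measure) \<Rightarrow> 'a measure \<Rightarrow> bool" where
  "maximal_irreducibility_measure N K \<psi> \<longleftrightarrow>
     irreducibility_measure N K \<psi> \<and>
     (\<forall>\<phi>. irreducibility_measure N K \<phi> \<longrightarrow> absolutely_continuous \<psi> \<phi>)"

text \<open>\<open>absolutely_continuous \<psi> \<phi>\<close> means \<open>\<phi> \<lless> \<psi>\<close>. Maximal irreducibility measures are mutually
  absolutely continuous, so the choice of \<open>\<psi>\<close> below does not matter.\<close>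

definition is_cycle ::
  "'a measure \<Rightarrow> ('a \<Rightarrow> 'a measure) \<Rightarrow> 'a measure \<Rightarrow> nat \<Rightarrow> (nat \<Rightarrow> 'a set) \<Rightarrow> bool" where
  "is_cycle N K \<psi> d D \<longleftrightarrow>
     d \<ge> 1 \<and> (\<forall>i<d. D i \<in> sets N) \<and> disjoint_family_on D {..<d} \<and>
     (\<forall>i<d. \<forall>x\<in>D i. emeasure (K x) (D (Suc i mod d)) = 1) \<and>
     emeasure \<psi> (space N - (\<Union>i<d. D i)) = 0"

text \<open>The period is the largest \<open>d\<close> admitting a \<open>d\<close>-cycle; \<open>d = 1\<close> always admits one.\<close>

definition aperiodic :: "'a measure \<Rightarrow> ('a \<Rightarrow> 'a measure) \<Rightarrow> bool" where
  "aperiodic N K \<longleftrightarrow>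
     (\<exists>\<psi>. maximal_irreducibility_measure N K \<psi> \<and> (\<forall>d D. is_cycle N K \<psi> d D \<longrightarrow> d = 1))"

definition harris_recurrent :: "'a measure \<Rightarrow> ('a \<Rightarrow> 'a measure) \<Rightarrow> bool" where
  "harris_recurrent N K \<longleftrightarrow>
     (\<exists>\<psi>. maximal_irreducibility_measure N K \<psi> \<and>
        (\<forall>A\<in>sets N. emeasure \<psi> A > 0 \<longrightarrow>
           (\<forall>x\<in>A. AE \<omega> in path_law N K x. \<exists>\<^sub>\<infinity>n. \<omega> n \<in> A)))"

definition invariant_probability :: "'a measure \<Rightarrow> ('a \<Rightarrow> 'a measure) \<Rightarrow> 'a measure \<Rightarrow> bool" where
  "invariant_probability N K \<pi> \<longleftrightarrow>
     prob_space \<pi> \<and> sets \<pi> = sets N \<and>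
     (\<forall>A\<in>sets N. emeasure \<pi> A = (\<integral>\<^sup>+ x. emeasure (K x) A \<partial>\<pi>))"

definition assumption_A :: "'a measure \<Rightarrow> ('a \<Rightarrow> 'a measure) \<Rightarrow> 'a measure \<Rightarrow> bool" where
  "assumption_A N K \<pi> \<longleftrightarrow>
     (\<exists>\<nu>. irreducibility_measure N K \<nu>) \<and> aperiodic N K \<and>
     harris_recurrent N K \<and> invariant_probability N K \<pi>"

end

theory Submission
  imports Defs
begin

text \<open>Each \<open>K x\<close> is a probability measure, so adding 1 to \<open>V\<close> adds 1
  to the one-step expectation, and the drift bound for \<open>V\<close> becomes
  \<open>\<gamma> * W x + L\<close>. The choice of \<open>\<rho>\<close> gives
  \<open>\<rho> - \<gamma> = a * (1 - \<rho>) > 0\<close>, so raising the rate from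
  \<open>\<gamma>\<close> to \<open>\<rho>\<close> gains \<open>a * (1 - \<rho>) * W x\<close>.
  Outside \<open>C\<close> this gain absorbs \<open>L\<close>; on \<open>C\<close> the term
  \<open>L\<close> is kept.\<close>

lemma next_step_expectation_one_plus:
  assumes K: "transition_kernel N K" and x: "x \<in> space N"
    and V: "V \<in> borel_measurable N"
    and nonneg: "\<And>y. y \<in> space N \<Longrightarrow> 0 \<le> V y"
    and W: "\<And>y. y \<in> space N \<Longrightarrow> W y = 1 + V y"
  shows "next_step_expectation K W x = 1 + next_step_expectation K V x"
proof -
  have "K x \<in> space (prob_algebra N)"
    using K x unfolding transition_kernel_def by (rule measurable_space)
  then have sets: "sets (K x) = sets N" and "prob_space (K x)"
    by (simp_all add: space_prob_algebra)
  then interpret prob_space "K x" by simp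
  have space: "space (K x) = space N"
    using sets by (rule sets_eq_imp_space_eq)
  have V': "V \<in> borel_measurable (K x)"
    using V by (simp cong: measurable_cong_sets add: sets)
  \<comment> \<open>\<open>ennreal\<close> truncates negative reals to 0, so it is additive here
    only because \<open>V\<close> is nonnegative on the space carrying \<open>K x\<close>.\<close>
  have "(\<integral>\<^sup>+ y. ennreal (W y) \<partial>K x) = (\<integral>\<^sup>+ y. 1 + ennreal (V y) \<partial>K x)"
    by (intro nn_integral_cong) (simp add: space W nonneg)
  also have "\<dots> = 1 + (\<integral>\<^sup>+ y. ennreal (V y) \<partial>K x)"
    using V' by (simp add: nn_integral_add emeasure_space_1)
  finally show ?thesis
    by (simp add: next_step_expectation_def plus_ennreal.rep_eq one_ennreal.rep_eq)
qed

theorem lemma3p1: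
  fixes S :: "(real ^ 'p) set"
    and M :: "'w measure"
    and X :: "nat \<Rightarrow> 'w \<Rightarrow> real ^ 'p"
    and K :: "real ^ 'p \<Rightarrow> (real ^ 'p) measure"
    and \<pi> :: "(real ^ 'p) measure"
    and V W :: "real ^ 'p \<Rightarrow> real"
    and \<gamma> b a \<rho> L :: real
    and C :: "(real ^ 'p) set"
  assumes "markov_chain (state_space S) M X K"
    and "assumption_A (state_space S) K \<pi>"
    and "V \<in> borel_measurable (state_space S)"
    and "\<forall>x\<in>S. 0 \<le> V x"
    and "0 < \<gamma>" and "\<gamma> < 1"
    and "\<forall>x\<in>S. next_step_expectation K V x \<le> ereal (\<gamma> * V x + b)"
    and "\<forall>x\<in>S. W x = 1 + V x"
    and "0 < a"
    and "\<rho> = (a + \<gamma>) / (a + 1)"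
    and "L = b + (1 - \<gamma>)"
    and "C = {x\<in>S. W x \<le> (a + 1) * L / (a * (1 - \<rho>))}"
  shows "\<forall>x\<in>S. next_step_expectation K W x \<le> ereal (\<rho> * W x + L * indicator C x)"
proof
  fix x assume x: "x \<in> S"
  have space: "space (state_space S) = S"
    by (simp add: space_restrict_space)
  have "next_step_expectation K W x = 1 + next_step_expectation K V x"
    by (rule next_step_expectation_one_plus[where N = "state_space S"])
      (use assms(1,3,4,8) x in \<open>auto simp: markov_chain_def space\<close>)
  also have "\<dots> \<le> 1 + ereal (\<gamma> * V x + b)"
    using assms(7) x by (intro add_left_mono) auto
  \<comment> \<open>Replacing \<open>V x\<close> by \<open>W x - 1\<close> leaves the constant
    \<open>1 + b - \<gamma>\<close>, which is \<open>L\<close>.\<close>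
  also have "\<dots> = ereal (\<gamma> * W x + L)"
    using assms(8,11) x by (simp add: one_ereal_def algebra_simps)
  also have "\<dots> \<le> ereal (\<rho> * W x + L * indicator C x)"
  proof -
    \<comment> \<open>Both sides equal \<open>a * (1 - \<gamma>) / (a + 1)\<close>. The right-hand
      side is the denominator of the threshold defining \<open>C\<close>.\<close>
    have gap: "\<rho> - \<gamma> = a * (1 - \<rho>)"
      using assms(9,10) by (simp add: field_simps)
    have "\<rho> < 1"
      using assms(6,9,10) by simp
    then have pos: "0 < a * (1 - \<rho>)"
      using assms(9) by simp
    have W: "0 \<le> W x"
      using assms(4,8) x by auto
    have nonneg: "0 \<le> (\<rho> - \<gamma>) * W x"
      using gap pos W by simp
    have "\<gamma> * W x + L \<le> \<rho> * W x + L * indicator C x"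
    proof (cases "x \<in> C")
      case True
      then show ?thesis
        using nonneg by (simp add: algebra_simps)
    next
      case False
      then have "(a + 1) * L / (a * (1 - \<rho>)) < W x"
        using assms(12) x by auto
      then have far: "(a + 1) * L < (\<rho> - \<gamma>) * W x"
        using pos unfolding gap by (simp add: pos_divide_less_eq mult.commute)
      have "L \<le> (\<rho> - \<gamma>) * W x"
      \<comment> \<open>The sign of \<open>b\<close> is not prescribed. For \<open>L \<ge> 0\<close>
        the factor \<open>a + 1 > 1\<close> in the threshold leaves room to spare; for negative
        \<open>L\<close> the nonnegative gain already suffices.\<close>
      proof (cases "0 \<le> L")
        case True
        then have "L \<le> (a + 1) * L"
          using assms(9) by (simp add: algebra_simps)
        then show ?thesis
          using far by linarith
      qed (use nonneg in linarith)
      then show ?thesis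
        using False by (simp add: algebra_simps)
    qed
    then show ?thesis by simp
  qed
  finally show "next_step_expectation K W x \<le> ereal (\<rho> * W x + L * indicator C x)" .
qed

end
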